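(* Let $m,n\ge 1$, let $A,B\in\mathbb{R}^{m\times n}$ be deterministic matrices, and let $\mathbf{M},\mathbf{N}$ be independent random matrices in $\mathbb{R}^{m\times n}$, each with i.i.d. standard (real) Gaussian entries. Define the real numbers $$x=\tfrac12\left(\|A+B\|_{F}+\|A-B\|_{F}\right),\qquad y=\tfrac12\left(\|A+B\|_{F}-\|A-B\|_{F}\right).$$ Then $$\operatorname{tr}\left[(A+\mathbf{N})^{t}(B+\mathbf{M})\right]\;\sim\;\left(x+N_{1}\right)\left(y+M_{1}\right)+Z_{mn-1}N,$$ where, on the right-hand side, $M_{1},N_{1},N\sim\mathcal{N}(0,1)$ and $Z_{mn-1}\sim\chi_{mn-1}$ are independent.
   Context: $\sim$ between random variables denotes equality in distribution. $\|\cdot\|_F$ is the Frobenius norm, $\|A\|_F=\left(\sum_{i,j}A_{ij}^2\right)^{1/2}$, $A^t$ is the transpose and $\operatorname{tr}$ the trace. $\chi_k$ is the chi distribution with $k$ degrees of freedom, i.e. the law of $\left(\sum_{i=1}^{k}G_i^2\right)^{1/2}$ with $G_1,\dots,G_k$ i.i.d. standard Gaussian (for $k=0$ it is the point mass at $0$). *)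

theory Defs
  imports "HOL-Probability.Probability"
begin

definition frobenius_norm :: "real^'n^'m \<Rightarrow> real" where
  "frobenius_norm A = sqrt (\<Sum>i\<in>UNIV. \<Sum>j\<in>UNIV. (A $ i $ j)\<^sup>2)"

definition std_gaussian_matrix :: "'w measure \<Rightarrow> ('w \<Rightarrow> real^'n^'m) \<Rightarrow> bool" where
  "std_gaussian_matrix P M \<longleftrightarrow>
     prob_space.indep_vars P (\<lambda>_. borel) (\<lambda>(i, j) \<omega>. M \<omega> $ i $ j) (UNIV :: ('m \<times> 'n) set) \<and>
     (\<forall>i j. distributed P lborel (\<lambda>\<omega>. M \<omega> $ i $ j) std_normal_density)"

text \<open>For \<open>k = 0\<close> the product measure lives on a single point and the empty sum is 0,
  so \<open>chi_distribution 0\<close> is the point mass at 0.\<close>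

definition chi_distribution :: "nat \<Rightarrow> real measure" where
  "chi_distribution k =
     distr (Pi\<^sub>M {..<k} (\<lambda>_. std_normal_distribution)) borel
       (\<lambda>g. sqrt (\<Sum>i<k. (g i)\<^sup>2))"

end

theory Submission
  imports Defs
begin

text \<open>
  Both sides have the same characteristic function, so Levy's uniqueness theorem applies.
  If \<open>U\<close> is independent of a standard Gaussian \<open>V\<close>, conditioning on \<open>U\<close> gives
  \<open>E exp (i t U (b + V)) = E (exp (i t b U) exp (- t\<^sup>2 U\<^sup>2 / 2))\<close>. For \<open>U = a + G\<close> with \<open>G\<close> Gaussian,
  completing the square evaluates this to
  \<open>(1 + t\<^sup>2) powr (- 1 / 2) exp ((i t a b - t\<^sup>2 (a\<^sup>2 + b\<^sup>2) / 2) / (1 + t\<^sup>2))\<close>.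
  Hence the left-hand side depends on \<open>A\<close> and \<open>B\<close> only through their inner product, which equals
  \<open>x y\<close>, and through the sum of the squares of their norms, which equals \<open>x\<^sup>2 + y\<^sup>2\<close>. The remaining factor
  \<open>(1 + t\<^sup>2) powr (- (m n - 1) / 2)\<close> is the characteristic function of \<open>Z N\<close>.
\<close>

section \<open>One-dimensional Gaussian integrals\<close>

text \<open>The characteristic function at \<open>t\<close> of \<open>u * (b + V)\<close> for a
  standard Gaussian \<open>V\<close>, that is, of \<open>U * (b + V)\<close> conditioned on
  \<open>U = u\<close>.\<close>

definition gauss_weight :: "real \<Rightarrow> real \<Rightarrow> real \<Rightarrow> complex" where
  "gauss_weight t b u = iexp (t * (u * b)) * of_real (exp (- ((t * u)\<^sup>2) / 2))"

text \<open>With \<open>p = a * b\<close> and \<open>q = a\<^sup>2 + b\<^sup>2\<close> this is the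
  characteristic function of (a + G)(b + V), for independent standard Gaussians G and V, stripped of
  its factor \<open>1 / sqrt (1 + t\<^sup>2)\<close>.\<close>

definition bilinear_char :: "real \<Rightarrow> real \<Rightarrow> real \<Rightarrow> complex" where
  "bilinear_char t p q =
     of_real (exp (- (t\<^sup>2 * q / (2 * (1 + t\<^sup>2))))) * iexp (t * p / (1 + t\<^sup>2))"

lemma gauss_weight_measurable [measurable]: "gauss_weight t b \<in> borel_measurable borel"
  unfolding gauss_weight_def by measurable

lemma norm_gauss_weight_le: "norm (gauss_weight t b u) \<le> 1"
  by (simp add: gauss_weight_def norm_mult)

text \<open>The exponent is linear in \<open>p\<close> and \<open>q\<close> jointly. Hence a product
  over matrix entries retains only an inner product and a sum of squared norms.\<close>

lemma bilinear_char_sum: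
  "(\<Prod>i\<in>I. bilinear_char t (p i) (q i)) = bilinear_char t (\<Sum>i\<in>I. p i) (\<Sum>i\<in>I. q i)"
proof (induction I rule: infinite_finite_induct)
  case (insert i I)
  have "bilinear_char t (p i) (q i) * bilinear_char t p' q' =
        bilinear_char t (p i + p') (q i + q')" for p' q'
  proof -
    have "exp (- (t\<^sup>2 * (q i + q') / (2 * (1 + t\<^sup>2)))) =
        exp (- (t\<^sup>2 * q i / (2 * (1 + t\<^sup>2)))) * exp (- (t\<^sup>2 * q' / (2 * (1 + t\<^sup>2))))"
      by (simp add: distrib_left add_divide_distrib flip: exp_add)
    moreover have "iexp (t * (p i + p') / (1 + t\<^sup>2)) =
        iexp (t * p i / (1 + t\<^sup>2)) * iexp (t * p' / (1 + t\<^sup>2))"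
      by (simp add: distrib_left add_divide_distrib flip: exp_add)
    ultimately show ?thesis
      by (simp only: bilinear_char_def of_real_mult mult_ac)
  qed
  with insert show ?case by simp
\<comment> \<open>Over an empty or infinite index set the sums are 0 and the product is 1, in
  agreement with \<open>bilinear_char t 0 0 = 1\<close>.\<close>
qed (auto simp: bilinear_char_def)

lemma integral_gauss_weight:
  "(LINT g|std_normal_distribution. gauss_weight t b (a + g)) =
     of_real (1 / sqrt (1 + t\<^sup>2)) * bilinear_char t (a * b) (a\<^sup>2 + b\<^sup>2)"
proof -
  define s where "s = sqrt (1 + t\<^sup>2)"
  have s2: "s\<^sup>2 = 1 + t\<^sup>2" and s0: "s > 0"
    by (auto simp: s_def add_pos_nonneg)
  \<comment> \<open>Completing the square in g^2 + t^2 (a + g)^2 suggests g = - a t^2 / s^2 + u / s.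
    Then a + g is centred at \<open>v\<close>, and \<open>w\<close> is the constant factor left
    over.\<close>
  define v where "v = a / s\<^sup>2"
  define w where "w = exp (- (t\<^sup>2 * a\<^sup>2 / (2 * s\<^sup>2)))"
  have square: "- (- a * t\<^sup>2 / s\<^sup>2 + u / s)\<^sup>2 / 2 - (t * (v + u / s))\<^sup>2 / 2 =
      - u\<^sup>2 / 2 - t\<^sup>2 * a\<^sup>2 / (2 * s\<^sup>2)" for u
  proof -
    \<comment> \<open>In terms of the reciprocal \<open>r\<close> the claim is a polynomial identity
      modulo the single relation \<open>r\<^sup>2 * (1 + t\<^sup>2) = 1\<close>.\<close>
    define r where "r = 1 / s"
    have r: "r\<^sup>2 * (1 + t\<^sup>2) = 1"
      using s0 by (simp add: r_def power_divide flip: s2)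
    have "(- a * t\<^sup>2 * r\<^sup>2 + u * r)\<^sup>2 + (t * (a * r\<^sup>2 + u * r))\<^sup>2 = u\<^sup>2 + t\<^sup>2 * a\<^sup>2 * r\<^sup>2"
      using r by algebra
    then show ?thesis
      by (simp add: r_def v_def field_simps power_divide)
  qed
  have shift: "a + (- a * t\<^sup>2 / s\<^sup>2 + u / s) = v + u / s" for u
  proof -
    have "s\<^sup>2 \<noteq> 0" using s0 by simp
    then have "a - a * t\<^sup>2 / s\<^sup>2 = v"
      by (simp add: v_def field_simps) (simp add: s2 algebra_simps)
    then show ?thesis by simp
  qed
  have integrand: "std_normal_density (- a * t\<^sup>2 / s\<^sup>2 + 1 / s * u) *\<^sub>R
        gauss_weight t b (a + (- a * t\<^sup>2 / s\<^sup>2 + 1 / s * u)) =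
      (of_real w * iexp (t * b * v)) * (std_normal_density u *\<^sub>R iexp (t * b / s * u))" for u
  proof -
    have "exp (- (- a * t\<^sup>2 / s\<^sup>2 + u / s)\<^sup>2 / 2) * exp (- ((t * (v + u / s))\<^sup>2) / 2) =
        w * exp (- u\<^sup>2 / 2)"
      unfolding exp_add[symmetric] w_def using square[of u] by (simp add: algebra_simps)
    then have real_part: "std_normal_density (- a * t\<^sup>2 / s\<^sup>2 + u / s) * exp (- ((t * (v + u / s))\<^sup>2) / 2) =
        w * std_normal_density u"
      by (simp add: std_normal_density_def)
    have "iexp (t * ((v + u / s) * b)) = iexp (t * b * v) * iexp (t * b / s * u)"
      by (simp add: algebra_simps flip: exp_add)
    then have "std_normal_density (- a * t\<^sup>2 / s\<^sup>2 + u / s) *\<^sub>R gauss_weight t b (v + u / s) =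
        of_real (std_normal_density (- a * t\<^sup>2 / s\<^sup>2 + u / s) * exp (- ((t * (v + u / s))\<^sup>2) / 2)) *
        (iexp (t * b * v) * iexp (t * b / s * u))"
      by (simp add: gauss_weight_def scaleR_conv_of_real mult_ac)
    also have "\<dots> = (of_real w * iexp (t * b * v)) * (std_normal_density u *\<^sub>R iexp (t * b / s * u))"
      unfolding real_part by (simp add: scaleR_conv_of_real mult_ac)
    finally show ?thesis
      by (simp only: times_divide_eq_left mult_1 shift)
  qed
  have "(LINT g|std_normal_distribution. gauss_weight t b (a + g)) =
      (LINT g|lborel. std_normal_density g *\<^sub>R gauss_weight t b (a + g))"
    by (subst integral_density) auto
  \<comment> \<open>The Jacobian of the substitution supplies the prefactor
    \<open>1 / sqrt (1 + t\<^sup>2)\<close>.\<close>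
  also have "\<dots> = \<bar>1 / s\<bar> *\<^sub>R (LINT u|lborel. std_normal_density (- a * t\<^sup>2 / s\<^sup>2 + 1 / s * u) *\<^sub>R
      gauss_weight t b (a + (- a * t\<^sup>2 / s\<^sup>2 + 1 / s * u)))"
    using s0 by (intro lborel_integral_real_affine) simp
  also have "\<dots> = (1 / s) *\<^sub>R (of_real w * iexp (t * b * v) *
      (LINT u|lborel. std_normal_density u *\<^sub>R iexp (t * b / s * u)))"
    unfolding integrand using s0 by (simp only: integral_mult_right_zero abs_of_pos zero_less_divide_1_iff)
  also have "(LINT u|lborel. std_normal_density u *\<^sub>R iexp (t * b / s * u)) =
      char std_normal_distribution (t * b / s)"
    unfolding char_def by (subst integral_density) auto
  also have "\<dots> = of_real (exp (- (t * b / s)\<^sup>2 / 2))"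
    by (simp add: char_std_normal_distribution)
  also have "(1 / s) *\<^sub>R (of_real w * iexp (t * b * v) * complex_of_real (exp (- (t * b / s)\<^sup>2 / 2))) =
      of_real (1 / s) * (of_real (w * exp (- (t * b / s)\<^sup>2 / 2)) * iexp (t * b * v))"
    by (simp add: scaleR_conv_of_real mult_ac)
  \<comment> \<open>The leftover \<open>w\<close> carries a and the Gaussian characteristic function
    carries b, with the same coefficient, so the result is symmetric in a and b.\<close>
  also have "w * exp (- (t * b / s)\<^sup>2 / 2) = exp (- (t\<^sup>2 * (a\<^sup>2 + b\<^sup>2) / (2 * s\<^sup>2)))"
    unfolding w_def exp_add[symmetric] using s0
    by (simp add: power_divide power_mult_distrib field_simps)
  finally show ?thesis
    using s0 unfolding bilinear_char_def s2[symmetric] by (simp add: v_def mult_ac)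
qed

section \<open>Conditioning on an independent factor\<close>

text \<open>Fubini for the joint law, which is a product by independence; boundedness gives
  integrability. Pulling both marginals back to \<open>M\<close> keeps the inner integral an
  expectation.\<close>

lemma (in prob_space) indep_var_integral_iterated:
  fixes f :: "'b \<times> 'b \<Rightarrow> 'c::{banach, second_countable_topology}"
  assumes indep: "indep_var S X T Y"
    and f [measurable]: "f \<in> borel_measurable (S \<Otimes>\<^sub>M T)"
    and bound: "\<And>z. norm (f z) \<le> C"
  shows "(LINT \<omega>|M. f (X \<omega>, Y \<omega>)) = (LINT \<omega>|M. LINT \<omega>'|M. f (X \<omega>, Y \<omega>'))"
proof -
  have [measurable]: "X \<in> measurable M S" "Y \<in> measurable M T"
    using indep indep_var_rv1 indep_var_rv2 by blast+
  interpret X: prob_space "distr M S X" by (rule prob_space_distr) measurable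
  interpret Y: prob_space "distr M T Y" by (rule prob_space_distr) measurable
  interpret XY: pair_prob_space "distr M S X" "distr M T Y" ..
  have eq: "distr M S X \<Otimes>\<^sub>M distr M T Y = distr M (S \<Otimes>\<^sub>M T) (\<lambda>\<omega>. (X \<omega>, Y \<omega>))"
    using indep by (simp add: indep_var_distribution_eq)
  have "(LINT \<omega>|M. f (X \<omega>, Y \<omega>)) = integral\<^sup>L (distr M S X \<Otimes>\<^sub>M distr M T Y) f"
    unfolding eq by (simp add: integral_distr)
  also have "\<dots> = (LINT u|distr M S X. LINT v|distr M T Y. f (u, v))"
    by (intro XY.integral_fst'[symmetric] XY.integrable_const_bound[where B = C])
       (auto simp: bound)
  also have "\<dots> = (LINT \<omega>|M. LINT v|distr M T Y. f (X \<omega>, v))"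
    by (intro integral_distr) measurable
  also have "\<dots> = (LINT \<omega>|M. LINT \<omega>'|M. f (X \<omega>, Y \<omega>'))"
  proof (intro Bochner_Integration.integral_cong refl integral_distr)
    fix \<omega> assume "\<omega> \<in> space M"
    then have "X \<omega> \<in> space S"
      by (rule measurable_space[rotated]) measurable
    then show "(\<lambda>v. f (X \<omega>, v)) \<in> borel_measurable T"
      by measurable
  qed measurable
  finally show ?thesis .
qed

lemma (in prob_space) char_std_normal_affine:
  assumes "distributed M lborel V std_normal_density"
  shows "(LINT \<omega>|M. iexp (t * (u * (b + V \<omega>)))) = gauss_weight t b u"
proof -
  have [measurable]: "V \<in> borel_measurable M"
    using assms by (simp add: distributed_def)
  have law: "distr M borel V = std_normal_distribution"
    using assms by (simp add: distributed_def cong: distr_cong)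
  have "(LINT \<omega>|M. iexp (t * (u * (b + V \<omega>)))) =
      (LINT \<omega>|M. iexp (t * (u * b)) * iexp (t * u * V \<omega>))"
    by (simp add: algebra_simps flip: exp_add)
  also have "\<dots> = iexp (t * (u * b)) * (LINT v|distr M borel V. iexp (t * u * v))"
    by (simp add: integral_distr)
  also have "(LINT v|distr M borel V. iexp (t * u * v)) = of_real (exp (- (t * u)\<^sup>2 / 2))"
    unfolding law using fun_cong[OF char_std_normal_distribution, of "t * u"] by (simp only: char_def)
  finally show ?thesis
    by (simp add: gauss_weight_def)
qed

lemma (in prob_space) integral_gauss_weight_distributed:
  assumes "distributed M lborel U std_normal_density"
  shows "(LINT \<omega>|M. gauss_weight t b (a + U \<omega>)) =
    of_real (1 / sqrt (1 + t\<^sup>2)) * bilinear_char t (a * b) (a\<^sup>2 + b\<^sup>2)"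
proof -
  have [measurable]: "U \<in> borel_measurable M"
    using assms by (simp add: distributed_def)
  have law: "distr M borel U = std_normal_distribution"
    using assms by (simp add: distributed_def cong: distr_cong)
  have "(LINT \<omega>|M. gauss_weight t b (a + U \<omega>)) = (LINT u|distr M borel U. gauss_weight t b (a + u))"
    by (simp add: integral_distr)
  then show ?thesis
    unfolding law integral_gauss_weight .
qed

text \<open>Integrating out \<open>V\<close> first leaves the weight at \<open>U\<close>. This
  serves both products on the right-hand side of the theorem: \<open>U = x + N1\<close> with
  \<open>b = y\<close>, and \<open>U = Z\<close> with \<open>b = 0\<close>.\<close>

lemma (in prob_space) char_mult_std_normal:
  assumes indep: "indep_var borel U borel V"
    and V: "distributed M lborel V std_normal_density"
  shows "char (distr M borel (\<lambda>\<omega>. U \<omega> * (b + V \<omega>))) t = (LINT \<omega>|M. gauss_weight t b (U \<omega>))"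
proof -
  have [measurable]: "U \<in> borel_measurable M" "V \<in> borel_measurable M"
    using indep indep_var_rv1 indep_var_rv2 by blast+
  have "char (distr M borel (\<lambda>\<omega>. U \<omega> * (b + V \<omega>))) t =
      (LINT \<omega>|M. (\<lambda>(u, v). iexp (t * (u * (b + v)))) (U \<omega>, V \<omega>))"
    by (simp add: char_def integral_distr)
  also have "\<dots> = (LINT \<omega>|M. LINT \<omega>'|M. (\<lambda>(u, v). iexp (t * (u * (b + v)))) (U \<omega>, V \<omega>'))"
    by (rule indep_var_integral_iterated[OF indep, where C = 1]) auto
  finally show ?thesis
    by (simp only: prod.case char_std_normal_affine[OF V])
qed

text \<open>For \<open>b = 0\<close> the weight is a Gaussian function of z, so the sum of squares
  in the chi variable turns it into a product over independent coordinates.\<close>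

lemma integral_gauss_weight_chi:
  "(LINT z|chi_distribution k. gauss_weight t 0 z) = of_real (1 / sqrt (1 + t\<^sup>2)) ^ k"
proof -
  interpret std: prob_space std_normal_distribution
    by (simp add: prob_space_normal_density)
  interpret product_sigma_finite "\<lambda>_::nat. std_normal_distribution"
    by unfold_locales
  have prod: "gauss_weight t 0 (sqrt (\<Sum>i<k. (g i)\<^sup>2)) = (\<Prod>i<k. gauss_weight t 0 (0 + g i))" for g
    by (simp add: gauss_weight_def power_mult_distrib sum_nonneg sum_distrib_left sum_divide_distrib
        exp_sum flip: sum_negf of_real_prod)
  have "(LINT z|chi_distribution k. gauss_weight t 0 z) =
      (LINT g|Pi\<^sub>M {..<k} (\<lambda>_. std_normal_distribution). (\<Prod>i<k. gauss_weight t 0 (0 + g i)))"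
    unfolding chi_distribution_def prod[symmetric] by (intro integral_distr) measurable
  also have "\<dots> = (\<Prod>i<k. LINT g|std_normal_distribution. gauss_weight t 0 (0 + g))"
    by (intro product_integral_prod std.integrable_const_bound[where B = 1])
       (auto simp: norm_gauss_weight_le)
  also have "\<dots> = of_real (1 / sqrt (1 + t\<^sup>2)) ^ k"
    unfolding integral_gauss_weight by (simp add: bilinear_char_def)
  finally show ?thesis .
qed

section \<open>The trace of a product of Gaussian matrices\<close>

lemma matrix_entry_measurable [measurable]:
  fixes X :: "'a \<Rightarrow> real^'n^'m"
  assumes [measurable]: "X \<in> borel_measurable M"
  shows "(\<lambda>\<omega>. X \<omega> $ i $ j) \<in> borel_measurable M"
proof -
  have "(\<lambda>U::real^'n^'m. U $ i $ j) \<in> borel_measurable borel"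
    by (intro borel_measurable_continuous_onI continuous_intros)
  then show ?thesis
    by measurable
qed

lemma trace_transpose_mult:
  fixes U V :: "real^'n^'m"
  shows "trace (transpose U ** V) = (\<Sum>(i, j)\<in>UNIV. U $ i $ j * V $ i $ j)"
proof -
  have "trace (transpose U ** V) = (\<Sum>j\<in>UNIV. \<Sum>i\<in>UNIV. U $ i $ j * V $ i $ j)"
    by (simp add: trace_def matrix_matrix_mult_def transpose_def)
  also have "\<dots> = (\<Sum>i\<in>UNIV. \<Sum>j\<in>UNIV. U $ i $ j * V $ i $ j)"
    by (rule sum.swap)
  finally show ?thesis
    by (simp add: sum.cartesian_product)
qed

lemma trace_transpose_mult_measurable [measurable]:
  fixes X Y :: "'a \<Rightarrow> real^'n^'m"
  assumes [measurable]: "X \<in> borel_measurable M" "Y \<in> borel_measurable M"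
  shows "(\<lambda>\<omega>. trace (transpose (A + X \<omega>) ** (B + Y \<omega>))) \<in> borel_measurable M"
  unfolding trace_transpose_mult case_prod_unfold vector_add_component by measurable

lemma frobenius_norm_power2: "(frobenius_norm A)\<^sup>2 = (\<Sum>(i, j)\<in>UNIV. (A $ i $ j)\<^sup>2)"
  by (simp add: frobenius_norm_def sum.cartesian_product sum_nonneg case_prod_unfold)

text \<open>The trace is a sum of entrywise products. Independence of \<open>X\<close> and
  \<open>Y\<close> allows \<open>Y\<close> to be integrated out first; independence of the entries
  within each matrix then factors both integrals.\<close>

lemma (in prob_space) char_trace_gaussian:
  fixes A B :: "real^'n^'m" and X Y :: "'a \<Rightarrow> real^'n^'m"
  assumes X: "std_gaussian_matrix M X" and Y: "std_gaussian_matrix M Y"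
    and indep: "indep_var borel X borel Y"
  shows "char (distr M borel (\<lambda>\<omega>. trace (transpose (A + X \<omega>) ** (B + Y \<omega>)))) t =
    of_real (1 / sqrt (1 + t\<^sup>2)) ^ (CARD('m) * CARD('n)) *
    bilinear_char t (\<Sum>(i, j)\<in>UNIV. A $ i $ j * B $ i $ j) ((frobenius_norm A)\<^sup>2 + (frobenius_norm B)\<^sup>2)"
proof -
  have [measurable]: "X \<in> borel_measurable M" "Y \<in> borel_measurable M"
    using indep indep_var_rv1 indep_var_rv2 by blast+
  have Xi: "indep_vars (\<lambda>_. borel) (\<lambda>p \<omega>. X \<omega> $ fst p $ snd p) UNIV"
    and Xd: "\<And>p. distributed M lborel (\<lambda>\<omega>. X \<omega> $ fst p $ snd p) std_normal_density"
    and Yi: "indep_vars (\<lambda>_. borel) (\<lambda>p \<omega>. Y \<omega> $ fst p $ snd p) UNIV"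
    and Yd: "\<And>p. distributed M lborel (\<lambda>\<omega>. Y \<omega> $ fst p $ snd p) std_normal_density"
    using X Y by (simp_all add: std_gaussian_matrix_def case_prod_unfold)
  define f :: "(real^'n^'m) \<times> (real^'n^'m) \<Rightarrow> complex" where
    "f z = (\<Prod>p\<in>UNIV. iexp (t * ((A $ fst p $ snd p + fst z $ fst p $ snd p) *
      (B $ fst p $ snd p + snd z $ fst p $ snd p))))" for z
  have [measurable]: "f \<in> borel_measurable (borel \<Otimes>\<^sub>M borel)"
    unfolding f_def by measurable
  have tr: "iexp (t * trace (transpose (A + X \<omega>) ** (B + Y \<omega>))) = f (X \<omega>, Y \<omega>)" for \<omega>
    by (simp add: f_def trace_transpose_mult case_prod_unfold sum_distrib_left exp_sum)
  \<comment> \<open>For a fixed first matrix \<open>u\<close> each factor involves a single entry of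
    \<open>Y\<close>.\<close>
  have inner: "(LINT \<omega>'|M. f (u, Y \<omega>')) =
      (\<Prod>p\<in>UNIV. gauss_weight t (B $ fst p $ snd p) (A $ fst p $ snd p + u $ fst p $ snd p))" for u
  proof -
    have "(LINT \<omega>'|M. f (u, Y \<omega>')) =
        (\<Prod>p\<in>UNIV. LINT \<omega>'|M. iexp (t * ((A $ fst p $ snd p + u $ fst p $ snd p) *
          (B $ fst p $ snd p + Y \<omega>' $ fst p $ snd p))))"
      unfolding f_def fst_conv snd_conv
      by (rule indep_vars_lebesgue_integral)
         (auto intro!: indep_vars_compose2[OF Yi] integrable_const_bound[where B = 1])
    then show ?thesis
      by (simp only: char_std_normal_affine[OF Yd])
  qed
  have "char (distr M borel (\<lambda>\<omega>. trace (transpose (A + X \<omega>) ** (B + Y \<omega>)))) t =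
      (LINT \<omega>|M. f (X \<omega>, Y \<omega>))"
    unfolding char_def tr[symmetric] by (intro integral_distr) measurable
  also have "\<dots> = (LINT \<omega>|M. LINT \<omega>'|M. f (X \<omega>, Y \<omega>'))"
    by (rule indep_var_integral_iterated[OF indep, where C = 1]) (auto simp: f_def simp flip: prod_norm)
  also have "\<dots> = (\<Prod>p\<in>UNIV. LINT \<omega>|M. gauss_weight t (B $ fst p $ snd p)
      (A $ fst p $ snd p + X \<omega> $ fst p $ snd p))"
    unfolding inner
    by (rule indep_vars_lebesgue_integral)
       (auto intro!: indep_vars_compose2[OF Xi] integrable_const_bound[where B = 1] simp: norm_gauss_weight_le)
  also have "\<dots> = of_real (1 / sqrt (1 + t\<^sup>2)) ^ (CARD('m) * CARD('n)) *
      bilinear_char t (\<Sum>(i, j)\<in>UNIV. A $ i $ j * B $ i $ j) ((frobenius_norm A)\<^sup>2 + (frobenius_norm B)\<^sup>2)"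
    unfolding integral_gauss_weight_distributed[OF Xd] prod.distrib bilinear_char_sum
    by (simp add: frobenius_norm_power2 sum.distrib case_prod_unfold)
  finally show ?thesis .
qed

text \<open>The parallelogram and polarization identities; they turn x^2 + y^2 and x y into the two
  invariants of \<open>A\<close> and \<open>B\<close> found above.\<close>

lemma frobenius_norm_add_sub:
  fixes A B :: "real^'n^'m"
  shows "(frobenius_norm (A + B))\<^sup>2 + (frobenius_norm (A - B))\<^sup>2 =
      2 * ((frobenius_norm A)\<^sup>2 + (frobenius_norm B)\<^sup>2)"
    and "(frobenius_norm (A + B))\<^sup>2 - (frobenius_norm (A - B))\<^sup>2 =
      4 * (\<Sum>(i, j)\<in>UNIV. A $ i $ j * B $ i $ j)"
  by (simp_all add: frobenius_norm_power2 power2_sum power2_diff sum.distrib sum_subtractf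
      sum_distrib_left case_prod_unfold mult.assoc)

section \<open>Comparison of the two characteristic functions\<close>

theorem theorem2p7:
  fixes A B :: "real^'n^'m"
    and P :: "'w measure" and M N :: "'w \<Rightarrow> real^'n^'m"
    and Q :: "'v measure" and M1 N1 N' Z :: "'v \<Rightarrow> real"
    and x y :: real
  assumes P: "prob_space P"
    and M: "std_gaussian_matrix P M"
    and N: "std_gaussian_matrix P N"
    and MN: "prob_space.indep_var P borel M borel N"
    and x: "x = (frobenius_norm (A + B) + frobenius_norm (A - B)) / 2"
    and y: "y = (frobenius_norm (A + B) - frobenius_norm (A - B)) / 2"
    and Q: "prob_space Q"
    and M1: "distributed Q lborel M1 std_normal_density"
    and N1: "distributed Q lborel N1 std_normal_density"
    and N': "distributed Q lborel N' std_normal_density"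
    and Z: "distr Q borel Z = chi_distribution (CARD('m) * CARD('n) - 1)"
    and indep: "prob_space.indep_vars Q (\<lambda>_. borel) (\<lambda>i. [M1, N1, N', Z] ! i) {..<4}"
  shows "distr P borel (\<lambda>\<omega>. trace (transpose (A + N \<omega>) ** (B + M \<omega>))) =
         distr Q borel (\<lambda>\<omega>. (x + N1 \<omega>) * (y + M1 \<omega>) + Z \<omega> * N' \<omega>)"
proof -
  interpret P: prob_space P by fact
  interpret Q: prob_space Q by fact
  define k where "k = CARD('m) * CARD('n) - 1"
  \<comment> \<open>Index types are nonempty, so the truncated subtraction is exact. One factor
    \<open>1 / sqrt (1 + t\<^sup>2)\<close> will come from \<open>N1\<close> and the other
    \<open>k\<close> from \<open>Z\<close>.\<close>
  have card: "CARD('m) * CARD('n) = Suc k"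
    by (simp add: k_def)
  let ?L = "\<lambda>\<omega>. trace (transpose (A + N \<omega>) ** (B + M \<omega>))"
  let ?R = "\<lambda>\<omega>. (x + N1 \<omega>) * (y + M1 \<omega>) + Z \<omega> * N' \<omega>"
  have [measurable]: "M \<in> borel_measurable P" "N \<in> borel_measurable P"
    using MN P.indep_var_rv1 P.indep_var_rv2 by blast+
  have Lmeas: "?L \<in> borel_measurable P"
    by measurable
  \<comment> \<open>Functions of disjoint blocks of the four variables are independent; the indices
    0, 1, 2, 3 stand for \<open>M1\<close>, \<open>N1\<close>, \<open>N'\<close>,
    \<open>Z\<close>.\<close>
  have pair: "Q.indep_var borel (f \<circ> (\<lambda>\<omega>. restrict (\<lambda>i. ([M1, N1, N', Z] ! i) \<omega>) I))
      borel (g \<circ> (\<lambda>\<omega>. restrict (\<lambda>i. ([M1, N1, N', Z] ! i) \<omega>) J))"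
    if "I \<inter> J = {}" "I \<subseteq> {..<4}" "J \<subseteq> {..<4}" "f \<in> borel_measurable (Pi\<^sub>M I (\<lambda>_. borel))"
      "g \<in> borel_measurable (Pi\<^sub>M J (\<lambda>_. borel))" for I J f g
    using that by (intro Q.indep_var_compose[OF Q.indep_var_restrict[OF indep]])
  have indep_NM: "Q.indep_var borel (\<lambda>\<omega>. x + N1 \<omega>) borel M1"
    using pair[of "{1}" "{0}" "\<lambda>h. x + h 1" "\<lambda>h. h 0"] by (simp add: comp_def)
  have indep_ZN: "Q.indep_var borel Z borel N'"
    using pair[of "{3}" "{2}" "\<lambda>h. h 3" "\<lambda>h. h 2"] by (simp add: comp_def)
  \<comment> \<open>The summand 0 gives the second product the shape U (b + V) with b = 0.\<close>
  have indep_sum: "Q.indep_var borel (\<lambda>\<omega>. (x + N1 \<omega>) * (y + M1 \<omega>)) borel (\<lambda>\<omega>. Z \<omega> * (0 + N' \<omega>))"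
    using pair[of "{0, 1}" "{2, 3}" "\<lambda>h. (x + h 1) * (y + h 0)" "\<lambda>h. h 3 * (0 + h 2)"]
    by (simp add: comp_def)
  have [measurable]: "N1 \<in> borel_measurable Q" "M1 \<in> borel_measurable Q" "N' \<in> borel_measurable Q"
      "Z \<in> borel_measurable Q"
    using M1 N1 N' Q.indep_var_rv1[OF indep_ZN] by (simp_all add: distributed_def)
  have "char (distr P borel ?L) = char (distr Q borel ?R)"
  proof
    fix t
    let ?c = "complex_of_real (1 / sqrt (1 + t\<^sup>2))"
    have "char (distr Q borel ?R) t =
        (LINT \<omega>|Q. gauss_weight t y (x + N1 \<omega>)) * (LINT \<omega>|Q. gauss_weight t 0 (Z \<omega>))"
      using Q.char_distr_add[OF indep_sum, of t] Q.char_mult_std_normal[OF indep_NM M1, of y t]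
        Q.char_mult_std_normal[OF indep_ZN N', of 0 t] by simp
    also have "(LINT \<omega>|Q. gauss_weight t 0 (Z \<omega>)) = (LINT z|distr Q borel Z. gauss_weight t 0 z)"
      by (simp add: integral_distr)
    also have "\<dots> = ?c ^ k"
      unfolding Z k_def by (rule integral_gauss_weight_chi)
    also have "(LINT \<omega>|Q. gauss_weight t y (x + N1 \<omega>)) = ?c * bilinear_char t (x * y) (x\<^sup>2 + y\<^sup>2)"
      by (rule Q.integral_gauss_weight_distributed[OF N1])
    also have "x * y = (\<Sum>(i, j)\<in>UNIV. A $ i $ j * B $ i $ j)"
      using frobenius_norm_add_sub(2)[of A B] unfolding x y by (simp add: field_simps power2_eq_square)
    also have "x\<^sup>2 + y\<^sup>2 = (frobenius_norm A)\<^sup>2 + (frobenius_norm B)\<^sup>2"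
      using frobenius_norm_add_sub(1)[of A B] unfolding x y by (simp add: field_simps power2_eq_square)
    \<comment> \<open>\<open>MN\<close> lists \<open>M\<close> first, so the trace formula is
      applied with \<open>A\<close> and \<open>B\<close> exchanged; the entrywise sum is symmetric
      under this exchange.\<close>
    finally show "char (distr P borel ?L) t = char (distr Q borel ?R) t"
      using P.char_trace_gaussian[OF M N MN, of B A t] by (simp add: card trace_transpose_mult mult_ac add_ac)
  qed
  then show ?thesis
    by (intro Levy_uniqueness P.real_distribution_distr Q.real_distribution_distr) (use Lmeas in auto)
qed

end
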